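(* Let $U, V_1,\dots,V_p$, $A$, $R_i$, $R_i^*$, $f$, $u^0$, $\bm V$, $\bm B,\bm B_0$ be as in the context, with in particular $U=R_1^*V_1\oplus\dots\oplus R_p^*V_p$, $R_iR_i^*=I_i$ and $R_iR_j^*=0$ for $i\ne j$. Consider the three-level scheme $$\frac{\bm w^{n+1}-\bm w^{n-1}}{2\tau}+\bm B_0\big(\sigma\bm w^{n+1}+(1-2\sigma)\bm w^n+\sigma\bm w^{n-1}\big)+(\bm B-\bm B_0)\bm w^n=\bm f^n,\quad n=1,\dots,N-1,$$ with initial data $\bm w^0=\bm v^0$, $\bm w^1=\widetilde{\bm v}^1$ ($\widetilde{\bm v}^1\in\bm V$ given), where $\sigma>0$ is a constant. The scheme has second order of approximation in $\tau$ (in the sense stated in the context). If $\sigma\ge\frac p4$, it is unconditionally stable; that is, for every time step $\tau>0$ (with $N\tau=T$), the operator $$\bm D=\tau^2\Big(\sigma\bm B_0-\frac14\bm B\Big)$$ satisfies $\bm D=\bm D^*\ge0$, and the approximate solution $y^n=\sum_{i=1}^pR_i^*w_i^n$, $y^{n+1/2}=\frac12(y^{n+1}+y^n)$, satisfies for all $n=1,\dots,N-1$ $$\|y^{n+1/2}\|_A^2\le\|y^{1/2}\|_A^2+\Big(\bm D\,\frac{\widetilde{\bm v}^1-\bm v^0}{\tau},\frac{\widetilde{\bm v}^1-\bm v^0}{\tau}\Big)+\frac12\sum_{k=1}^n\tau\|f^k\|^2 .$$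
   Context: $U$ is a finite-dimensional real Hilbert space with scalar product $(\cdot,\cdot)$ and norm $\|\cdot\|$. $A:U\to U$ is a linear operator, independent of $t$, self-adjoint and positive definite ($A=A^*>0$); $\|u\|_A=(Au,u)^{1/2}$. The problem being approximated is the Cauchy problem $\frac{du}{dt}+Au=f(t)$, $0<t\le T$, $u(0)=u^0\in U$, with given $f:[0,T]\to U$. $V_1,\dots,V_p$ ($p\ge1$) are finite-dimensional real Hilbert spaces with scalar products $(\cdot,\cdot)_i$ and identity operators $I_i$; $R_i:U\to V_i$ are linear operators with adjoints $R_i^*:V_i\to U$. It is assumed that $U$ is the direct sum $U=R_1^*V_1\oplus\dots\oplus R_p^*V_p$, with $u=\sum_iR_i^*v_i$, $v_i=R_iu$, for each $u\in U$, so that $R_iR_i^*=I_i$ and $R_iR_j^*=0$ for $i\neq j$. $\bm V=V_1\oplus\dots\oplus V_p$ with scalar product $(\bm v,\bm z)=\sum_{i=1}^p(v_i,z_i)_i$ for $\bm v=\{v_1,\dots,v_p\}$, $\bm z=\{z_1,\dots,z_p\}$. On $\bm V$ define $$\bm B=\{R_iAR_j^*\}_{i,j=1}^p,\quad \bm B_0=\mathrm{diag}\{R_1AR_1^*,\dots,R_pAR_p^*\}.$$ Time grid: $t^n=n\tau$, $n=0,\dots,N$, $N\tau=T$; $f^n=f(t^n)$; $\bm f(t)=\{R_1f(t),\dots,R_pf(t)\}\in\bm V$, $\bm f^n=\bm f(t^n)$; $\bm v^0=\{R_1u^0,\dots,R_pu^0\}$. Components of $\bm w^n\in\bm V$ are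 denoted $w_i^n$. Order of approximation: the scheme has order of approximation $m$ in $\tau$ if, for every sufficiently smooth solution $\bm v$ of $\frac{d\bm v}{dt}+\bm B\bm v=\bm f$ on $[0,T]$, substituting $\bm v(t^k)$ for $\bm w^k$ in the difference equation gives a residual (left-hand side minus right-hand side) bounded in norm by $M\tau^m$ with $M$ independent of $\tau$ and $n$. *)

theory Defs
  imports "HOL-Analysis.Analysis"
begin

text \<open>
  A finite-dimensional real Hilbert space is a finite-dimensional linear subspace of an ambient type
  of class \<^class>\<open>real_inner\<close>, with the inherited scalar product.  The space \<open>U\<close> is a whole type
  \<open>'u\<close>; the spaces \<open>V i\<close> may have different dimensions, so they are subspaces of one common ambient
  type \<open>'v\<close>.  This loses no generality, because finitely many such spaces embed isometrically into
  one real inner product space.  The index set is a finite type \<open>'p\<close>, with \<open>p = CARD('p)\<close>.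
\<close>

definition fin_dim_subspace :: "'a::real_vector set \<Rightarrow> bool" where
  "fin_dim_subspace S \<longleftrightarrow> (\<exists>b. finite b \<and> span b = S)"

text \<open>
  \<open>is_adjoint_on X Y F G\<close>: the operator \<open>F : X \<rightarrow> Y\<close> has the adjoint \<open>G : Y \<rightarrow> X\<close>.  The values of
  \<open>F\<close> outside \<open>X\<close> and of \<open>G\<close> outside \<open>Y\<close> are irrelevant; the library constant \<^const>\<open>adjoint\<close>
  only covers operators between whole types.
\<close>

definition is_adjoint_on ::
  "'a::real_inner set \<Rightarrow> 'b::real_inner set \<Rightarrow> ('a \<Rightarrow> 'b) \<Rightarrow> ('b \<Rightarrow> 'a) \<Rightarrow> bool" where
  "is_adjoint_on X Y F G \<longleftrightarrow>
     (\<forall>x\<in>X. F x \<in> Y) \<and> (\<forall>y\<in>Y. G y \<in> X) \<and> (\<forall>x\<in>X. \<forall>y\<in>Y. F x \<bullet> y = x \<bullet> G y)"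

abbreviation selfadjoint_on :: "'a::real_inner set \<Rightarrow> ('a \<Rightarrow> 'a) \<Rightarrow> bool" where
  "selfadjoint_on X F \<equiv> is_adjoint_on X X F F"

definition nonneg_on :: "'a::real_inner set \<Rightarrow> ('a \<Rightarrow> 'a) \<Rightarrow> bool" where
  "nonneg_on X F \<longleftrightarrow> (\<forall>x\<in>X. 0 \<le> F x \<bullet> x)"

definition pos_def :: "('a::real_inner \<Rightarrow> 'a) \<Rightarrow> bool" where
  "pos_def F \<longleftrightarrow> (\<forall>x. x \<noteq> 0 \<longrightarrow> 0 < F x \<bullet> x)"

definition energy_norm :: "('a::real_inner \<Rightarrow> 'a) \<Rightarrow> 'a \<Rightarrow> real" where
  "energy_norm A u = sqrt (A u \<bullet> u)"

text \<open>The whole space is the (internal) direct sum of the subspaces \<open>W i\<close>.\<close>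

definition is_direct_sum :: "('p::finite \<Rightarrow> 'a::real_vector set) \<Rightarrow> bool" where
  "is_direct_sum W \<longleftrightarrow> (\<forall>u. \<exists>!c. (\<forall>i. c i \<in> W i) \<and> u = (\<Sum>i\<in>UNIV. c i))"

text \<open>
  The space \<open>V\<^sub>1 \<oplus> \<dots> \<oplus> V\<^sub>p\<close>.  The library scalar product of \<open>'v ^ 'p\<close> is the sum of the
  scalar products of the components (\<open>inner_vec_def\<close>).
\<close>

definition prod_space :: "('p::finite \<Rightarrow> 'v::real_inner set) \<Rightarrow> ('v ^ 'p) set" where
  "prod_space V = {v. \<forall>i. v $ i \<in> V i}"

definition restrictions :: "('p::finite \<Rightarrow> 'u \<Rightarrow> 'v) \<Rightarrow> 'u \<Rightarrow> 'v ^ 'p" where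
  "restrictions R u = (\<chi> i. R i u)"

definition assemble :: "('p::finite \<Rightarrow> 'v \<Rightarrow> 'u::real_inner) \<Rightarrow> 'v ^ 'p \<Rightarrow> 'u" where
  "assemble Rs v = (\<Sum>i\<in>UNIV. Rs i (v $ i))"

definition op_B :: "('p::finite \<Rightarrow> 'u \<Rightarrow> 'v::real_inner) \<Rightarrow> ('p \<Rightarrow> 'v \<Rightarrow> 'u) \<Rightarrow> ('u \<Rightarrow> 'u)
    \<Rightarrow> 'v ^ 'p \<Rightarrow> 'v ^ 'p" where
  "op_B R Rs A v = (\<chi> i. \<Sum>j\<in>UNIV. R i (A (Rs j (v $ j))))"

definition op_B0 :: "('p::finite \<Rightarrow> 'u \<Rightarrow> 'v::real_inner) \<Rightarrow> ('p \<Rightarrow> 'v \<Rightarrow> 'u) \<Rightarrow> ('u \<Rightarrow> 'u)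
    \<Rightarrow> 'v ^ 'p \<Rightarrow> 'v ^ 'p" where
  "op_B0 R Rs A v = (\<chi> i. R i (A (Rs i (v $ i))))"

definition op_D :: "real \<Rightarrow> real \<Rightarrow> ('a::real_vector \<Rightarrow> 'a) \<Rightarrow> ('a \<Rightarrow> 'a) \<Rightarrow> 'a \<Rightarrow> 'a" where
  "op_D \<sigma> \<tau> B B0 v = \<tau>\<^sup>2 *\<^sub>R (\<sigma> *\<^sub>R B0 v - (1/4) *\<^sub>R B v)"

text \<open>Left-hand side of the three-level difference equation at level \<open>n \<ge> 1\<close>.\<close>

definition scheme_lhs :: "real \<Rightarrow> ('a::real_vector \<Rightarrow> 'a) \<Rightarrow> ('a \<Rightarrow> 'a) \<Rightarrow> real \<Rightarrow> (nat \<Rightarrow> 'a)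
    \<Rightarrow> nat \<Rightarrow> 'a" where
  "scheme_lhs \<sigma> B B0 \<tau> w n =
     (1 / (2 * \<tau>)) *\<^sub>R (w (n + 1) - w (n - 1))
     + B0 (\<sigma> *\<^sub>R w (n + 1) + (1 - 2 * \<sigma>) *\<^sub>R w n + \<sigma> *\<^sub>R w (n - 1))
     + (B (w n) - B0 (w n))"

text \<open>\<open>v\<close> is \<open>k\<close> times continuously differentiable on \<open>S\<close>, with one-sided derivatives at the
  endpoints when \<open>S\<close> is a closed interval.\<close>

definition Ck_on :: "nat \<Rightarrow> real set \<Rightarrow> (real \<Rightarrow> 'a::real_normed_vector) \<Rightarrow> bool" where
  "Ck_on k S v \<longleftrightarrow> (\<exists>d. d 0 = v \<and>
     (\<forall>j<k. \<forall>t\<in>S. (d j has_vector_derivative d (Suc j) t) (at t within S)) \<and>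
     continuous_on S (d k))"

definition ode_solution :: "real \<Rightarrow> 'a::real_normed_vector set \<Rightarrow> ('a \<Rightarrow> 'a) \<Rightarrow> (real \<Rightarrow> 'a)
    \<Rightarrow> (real \<Rightarrow> 'a) \<Rightarrow> bool" where
  "ode_solution T X B g v \<longleftrightarrow> (\<forall>t\<in>{0..T}. v t \<in> X \<and>
     (\<exists>v'. (v has_vector_derivative v') (at t within {0..T}) \<and> v' + B (v t) = g t))"

text \<open>
  Order of approximation \<open>m\<close> of the three-level scheme whose left-hand side is \<open>lhs \<tau> w n\<close> and
  whose right-hand side is \<open>g (n \<tau>)\<close>, for the equation \<open>dv/dt + B v = g\<close> in \<open>X\<close>.
  Sufficiently smooth means of class \<open>C\<^sup>m\<^sup>+\<^sup>1\<close>.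
\<close>

definition order_of_approximation :: "nat \<Rightarrow> real \<Rightarrow> 'a::real_normed_vector set \<Rightarrow> ('a \<Rightarrow> 'a)
    \<Rightarrow> (real \<Rightarrow> 'a) \<Rightarrow> (real \<Rightarrow> (nat \<Rightarrow> 'a) \<Rightarrow> nat \<Rightarrow> 'a) \<Rightarrow> bool" where
  "order_of_approximation m T X B g lhs \<longleftrightarrow>
     (\<forall>v. Ck_on (m + 1) {0..T} v \<and> ode_solution T X B g v \<longrightarrow>
       (\<exists>M. \<forall>N \<tau> n. 0 < \<tau> \<and> real N * \<tau> = T \<and> 1 \<le> n \<and> n \<le> N - 1 \<longrightarrow>
          norm (lhs \<tau> (\<lambda>k. v (real k * \<tau>)) n - g (real n * \<tau>)) \<le> M * \<tau> ^ m))"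

end

theory Submission
  imports Defs
begin

text \<open>
  Writing \<open>d\<^sub>n = (w\<^sup>n\<^sup>+\<^sup>1 - w\<^sup>n) / \<tau>\<close> and \<open>s\<^sub>n = (w\<^sup>n\<^sup>+\<^sup>1 + w\<^sup>n) / 2\<close>, the scheme takes the form
  \<open>D (d\<^sub>n - d\<^sub>n\<^sub>-\<^sub>1) / \<tau> + (w\<^sup>n\<^sup>+\<^sup>1 - w\<^sup>n\<^sup>-\<^sup>1) / (2 \<tau>) + B (s\<^sub>n + s\<^sub>n\<^sub>-\<^sub>1) / 2 = f\<^sup>n\<close>.  Its scalar product with
  \<open>w\<^sup>n\<^sup>+\<^sup>1 - w\<^sup>n\<^sup>-\<^sup>1 = \<tau> (d\<^sub>n + d\<^sub>n\<^sub>-\<^sub>1) = 2 (s\<^sub>n - s\<^sub>n\<^sub>-\<^sub>1)\<close> telescopes in the energy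
  \<open>(B s\<^sub>n, s\<^sub>n) + (D d\<^sub>n, d\<^sub>n)\<close>, and the right-hand side is absorbed by the dissipative middle term.
  The hypothesis \<open>\<sigma> \<ge> p/4\<close> gives \<open>D \<ge> 0\<close> because \<open>B \<le> p B\<^sub>0\<close> by the Cauchy-Schwarz inequality.
  The residual of a solution \<open>v\<close> is \<open>(v(t+\<tau>) - v(t-\<tau>)) / (2\<tau>) - v'(t) + \<sigma> B\<^sub>0 (v(t+\<tau>) - 2 v(t) + v(t-\<tau>))\<close>,
  which Taylor expansion bounds by a multiple of \<open>\<tau>\<^sup>2\<close>.
\<close>

section \<open>Operators on subspaces\<close>

lemma is_adjoint_on_sym:
  "is_adjoint_on X Y F G \<Longrightarrow> is_adjoint_on Y X G F"
  unfolding is_adjoint_on_def by (metis inner_commute)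

text \<open>An adjoint forces linearity on \<open>X\<close>: the defect \<open>z\<close> lies in
  \<open>Y\<close> and, by moving \<open>F\<close> across the scalar product, is orthogonal to every
  vector of \<open>Y\<close>, hence to itself. This gives the linearity of \<open>Rs i\<close> on
  \<open>V i\<close>, and of the operators in the abstract lemmas below, from adjointness
  alone.\<close>

lemma is_adjoint_on_linear:
  assumes adj: "is_adjoint_on X Y F G" and X: "subspace X" and Y: "subspace Y"
    and x: "x \<in> X" and y: "y \<in> X"
  shows "F (a *\<^sub>R x + b *\<^sub>R y) = a *\<^sub>R F x + b *\<^sub>R F y"
proof -
  define z where "z = F (a *\<^sub>R x + b *\<^sub>R y) - (a *\<^sub>R F x + b *\<^sub>R F y)"
  have xy: "a *\<^sub>R x + b *\<^sub>R y \<in> X"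
    using X x y by (intro subspace_add subspace_scale)
  have "z \<in> Y"
    unfolding z_def using adj X Y x y xy
    by (intro subspace_diff subspace_add subspace_scale) (auto simp: is_adjoint_on_def)
  then have "z \<bullet> z = 0"
    using adj x y xy unfolding is_adjoint_on_def
    by (subst (1) z_def) (simp add: inner_diff_left inner_add_left)
  then show ?thesis
    by (simp add: z_def)
qed

text \<open>Expanding \<open>x\<close> in a finite orthogonal spanning set bounds each coefficient
  by a multiple of \<open>norm x\<close> through Cauchy-Schwarz.\<close>

lemma linear_bounded_fin_dim:
  fixes F :: "'a::real_inner \<Rightarrow> 'b::real_normed_vector"
  assumes fin: "fin_dim_subspace (UNIV :: 'a set)" and F: "linear F"
  obtains K where "0 \<le> K" "\<And>x. norm (F x) \<le> K * norm x"
proof -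
  obtain b where b: "finite b" "span b = (UNIV :: 'a set)"
    using fin by (auto simp: fin_dim_subspace_def)
  obtain C where C: "finite C" "span C = (UNIV :: 'a set)" "pairwise orthogonal C"
    using basis_orthogonal[OF b(1)] b(2) by auto
  \<comment> \<open>\<open>C\<close> may contain 0; with the convention \<open>x / 0 = 0\<close>
    that term vanishes on both sides. The error \<open>z\<close> is orthogonal to \<open>C\<close>,
    hence to its span, which is the whole space, so it is 0.\<close>
  have expand: "x = (\<Sum>c\<in>C. (x \<bullet> c / (c \<bullet> c)) *\<^sub>R c)" for x
  proof -
    define z where "z = x - (\<Sum>c\<in>C. (x \<bullet> c / (c \<bullet> c)) *\<^sub>R c)"
    have "orthogonal z e" if e: "e \<in> C" for e
    proof -
      have "(\<Sum>c\<in>C. (x \<bullet> c / (c \<bullet> c)) *\<^sub>R c) \<bullet> e = (\<Sum>c\<in>C. if c = e then x \<bullet> e else 0)"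
        unfolding inner_sum_left using C(3) e
        by (intro sum.cong) (auto simp: pairwise_def orthogonal_def)
      then show ?thesis
        using C(1) e by (simp add: z_def orthogonal_def inner_diff_left)
    qed
    then have "orthogonal z z"
      using orthogonal_to_span[of z C z] C(2) by simp
    then show ?thesis
      by (simp add: orthogonal_def z_def)
  qed
  define K where "K = (\<Sum>c\<in>C. norm c / (c \<bullet> c) * norm (F c))"
  have "norm (F x) \<le> K * norm x" for x
  proof -
    have "F x = (\<Sum>c\<in>C. (x \<bullet> c / (c \<bullet> c)) *\<^sub>R F c)"
      by (subst expand[of x]) (simp add: linear_sum[OF F] linear_cmul[OF F])
    also have "norm \<dots> \<le> (\<Sum>c\<in>C. norm x * norm c / (c \<bullet> c) * norm (F c))"
      by (rule sum_norm_le)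
        (auto intro!: mult_right_mono divide_right_mono Cauchy_Schwarz_ineq2)
    also have "\<dots> = K * norm x"
      by (simp add: K_def sum_distrib_left sum_distrib_right mult_ac)
    finally show ?thesis .
  qed
  moreover have "0 \<le> K"
    by (auto simp: K_def intro!: sum_nonneg)
  ultimately show thesis
    using that by blast
qed

text \<open>Nonnegativity of the form at \<open>u i - u j\<close> bounds the mixed term by the two
  diagonal ones; summation over all pairs produces the factor \<open>card I\<close>. With
  \<open>u i = Rs i (v $ i)\<close> this is the comparison of \<open>B\<close> with \<open>p\<close>
  times \<open>B0\<close>.\<close>

lemma quadratic_form_sum_le:
  fixes A :: "'a::real_inner \<Rightarrow> 'a" and u :: "'i \<Rightarrow> 'a"
  assumes A: "linear A" and sym: "selfadjoint_on UNIV A" and nonneg: "nonneg_on UNIV A"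
  shows "A (\<Sum>i\<in>I. u i) \<bullet> (\<Sum>i\<in>I. u i) \<le> real (card I) * (\<Sum>i\<in>I. A (u i) \<bullet> u i)"
proof -
  have "2 * (A (u i) \<bullet> u j) \<le> A (u i) \<bullet> u i + A (u j) \<bullet> u j" for i j
  proof -
    have "0 \<le> A (u i - u j) \<bullet> (u i - u j)"
      using nonneg by (simp add: nonneg_on_def)
    moreover have "A (u j) \<bullet> u i = A (u i) \<bullet> u j"
      using sym unfolding is_adjoint_on_def by (metis UNIV_I inner_commute)
    ultimately show ?thesis
      by (simp add: linear_diff[OF A] inner_diff_left inner_diff_right)
  qed
  then have "(\<Sum>i\<in>I. \<Sum>j\<in>I. 2 * (A (u i) \<bullet> u j))
      \<le> (\<Sum>i\<in>I. \<Sum>j\<in>I. A (u i) \<bullet> u i + A (u j) \<bullet> u j)"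
    by (intro sum_mono)
  moreover have "A (\<Sum>i\<in>I. u i) \<bullet> (\<Sum>i\<in>I. u i) = (\<Sum>i\<in>I. \<Sum>j\<in>I. A (u i) \<bullet> u j)"
    unfolding linear_sum[OF A] inner_sum_left inner_sum_right by (rule sum.swap)
  ultimately show ?thesis
    by (simp add: sum.distrib sum_distrib_left[symmetric])
qed

section \<open>Order of approximation\<close>

text \<open>The induction step of Taylor estimation: by the mean value inequality on the segment
  from \<open>t\<close> to \<open>s\<close>, a bound of order \<open>k\<close> on the derivative
  becomes one of order \<open>k + 1\<close>. The factor \<open>1 / (k + 1)\<close> is given up,
  which only enlarges the constants. Derivatives within \<open>S\<close> cover the endpoints of the
  time interval.\<close>

lemma norm_le_power_Suc:
  fixes h :: "real \<Rightarrow> 'a::real_normed_vector"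
  assumes S: "convex S" and t: "t \<in> S" and s: "s \<in> S" and K: "0 \<le> K" and ht: "h t = 0"
    and deriv: "\<And>x. x \<in> S \<Longrightarrow> (h has_vector_derivative h' x) (at x within S)"
    and bound: "\<And>x. x \<in> S \<Longrightarrow> norm (h' x) \<le> K * \<bar>x - t\<bar> ^ k"
  shows "norm (h s) \<le> K * \<bar>s - t\<bar> ^ Suc k"
proof -
  let ?I = "closed_segment t s"
  have sub: "?I \<subseteq> S"
    using S t s by (rule closed_segment_subset[rotated 2])
  have "norm (h s - h t) \<le> (K * \<bar>s - t\<bar> ^ k) * norm (s - t)"
  proof (rule differentiable_bound[where S = ?I and f' = "\<lambda>x y. y *\<^sub>R h' x"])
    show "convex ?I" by simp
  next
    fix x assume x: "x \<in> ?I"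
    with sub have xS: "x \<in> S" by blast
    show "(h has_derivative (\<lambda>y. y *\<^sub>R h' x)) (at x within ?I)"
      using has_vector_derivative_within_subset[OF deriv[OF xS] sub]
      by (simp add: has_vector_derivative_def)
    have "\<bar>x - t\<bar> \<le> \<bar>s - t\<bar>"
      using x by (auto simp: closed_segment_eq_real_ivl split: if_splits)
    then have "norm (h' x) \<le> K * \<bar>s - t\<bar> ^ k"
      using bound[OF xS] K by (meson abs_ge_zero mult_left_mono order_trans power_mono)
    then show "onorm (\<lambda>y. y *\<^sub>R h' x) \<le> K * \<bar>s - t\<bar> ^ k"
      by (intro onorm_le) (simp add: mult.commute[of "K * _"] mult_left_mono)
  qed auto
  then show ?thesis
    by (simp add: ht mult_ac)
qed

lemma taylor_bound_1:
  fixes v :: "real \<Rightarrow> 'a::real_normed_vector"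
  assumes S: "convex S" and t: "t \<in> S" and s: "s \<in> S" and K: "0 \<le> K"
    and v: "\<And>x. x \<in> S \<Longrightarrow> (v has_vector_derivative v1 x) (at x within S)"
    and v1: "\<And>x. x \<in> S \<Longrightarrow> (v1 has_vector_derivative v2 x) (at x within S)"
    and bound: "\<And>x. x \<in> S \<Longrightarrow> norm (v2 x) \<le> K"
  shows "norm (v s - v t - (s - t) *\<^sub>R v1 t) \<le> K * \<bar>s - t\<bar> ^ 2"
proof -
  have first: "norm (v1 x - v1 t) \<le> K * \<bar>x - t\<bar> ^ Suc 0" if x: "x \<in> S" for x
    by (rule norm_le_power_Suc[OF S t x K, where h' = v2])
      (auto intro!: derivative_eq_intros v1 bound)
  have "norm (v s - v t - (s - t) *\<^sub>R v1 t) \<le> K * \<bar>s - t\<bar> ^ Suc (Suc 0)"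
    by (rule norm_le_power_Suc[OF S t s K, where h' = "\<lambda>x. v1 x - v1 t"])
      (use first in \<open>auto intro!: derivative_eq_intros v\<close>)
  then show ?thesis
    by (simp add: numeral_2_eq_2)
qed

text \<open>Differentiating the second-order remainder of \<open>v\<close> gives the first-order
  remainder of \<open>v1\<close>, to which the previous bound applies.\<close>

lemma taylor_bound_2:
  fixes v :: "real \<Rightarrow> 'a::real_normed_vector"
  assumes S: "convex S" and t: "t \<in> S" and s: "s \<in> S" and K: "0 \<le> K"
    and v: "\<And>x. x \<in> S \<Longrightarrow> (v has_vector_derivative v1 x) (at x within S)"
    and v1: "\<And>x. x \<in> S \<Longrightarrow> (v1 has_vector_derivative v2 x) (at x within S)"
    and v2: "\<And>x. x \<in> S \<Longrightarrow> (v2 has_vector_derivative v3 x) (at x within S)"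
    and bound: "\<And>x. x \<in> S \<Longrightarrow> norm (v3 x) \<le> K"
  shows "norm (v s - v t - (s - t) *\<^sub>R v1 t - ((s - t)\<^sup>2 / 2) *\<^sub>R v2 t) \<le> K * \<bar>s - t\<bar> ^ 3"
proof -
  have "norm (v s - v t - (s - t) *\<^sub>R v1 t - ((s - t)\<^sup>2 / 2) *\<^sub>R v2 t) \<le> K * \<bar>s - t\<bar> ^ Suc 2"
  proof (rule norm_le_power_Suc[OF S t s K, where h' = "\<lambda>x. v1 x - v1 t - (x - t) *\<^sub>R v2 t"])
    show "norm (v1 x - v1 t - (x - t) *\<^sub>R v2 t) \<le> K * \<bar>x - t\<bar> ^ 2" if "x \<in> S" for x
      by (rule taylor_bound_1[OF S t that K v1 v2 bound])
  qed (auto intro!: derivative_eq_intros v)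
  then show ?thesis
    by (simp add: eval_nat_numeral)
qed

text \<open>The differential equation cancels \<open>B (v t)\<close> exactly, leaving a central
  difference error and \<open>\<sigma> *\<^sub>R B0\<close> of a second difference. The resulting
  constant depends on bounds for the second and third derivatives, on \<open>C\<close> and on
  \<open>\<sigma>\<close>, but not on \<open>\<tau>\<close> or \<open>n\<close>.\<close>

lemma scheme_order_two:
  fixes B B0 :: "'a::real_inner \<Rightarrow> 'a"
  assumes X: "subspace X" and B0: "selfadjoint_on X B0"
    and C: "0 \<le> C" and bound: "\<And>x. x \<in> X \<Longrightarrow> norm (B0 x) \<le> C * norm x"
    and sigma: "0 \<le> \<sigma>"
  shows "order_of_approximation 2 T X B g (scheme_lhs \<sigma> B B0)"
  unfolding order_of_approximation_def
proof (intro allI impI, elim conjE)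
  fix v assume "Ck_on (2 + 1) {0..T} v" and sol: "ode_solution T X B g v"
  then obtain d where d0: "d 0 = v"
    and d: "\<And>j t. j < 3 \<Longrightarrow> t \<in> {0..T} \<Longrightarrow>
      (d j has_vector_derivative d (Suc j) t) (at t within {0..T})"
    and d3: "continuous_on {0..T} (d 3)"
    by (auto simp: Ck_on_def)
  have v: "(v has_vector_derivative d 1 t) (at t within {0..T})" if "t \<in> {0..T}" for t
    using d[of 0] that by (simp add: d0)
  have v1: "(d 1 has_vector_derivative d 2 t) (at t within {0..T})" if "t \<in> {0..T}" for t
    using d[of 1] that by (simp add: eval_nat_numeral)
  have v2: "(d 2 has_vector_derivative d 3 t) (at t within {0..T})" if "t \<in> {0..T}" for t
    using d[of 2] that by (simp add: eval_nat_numeral)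
  have d2: "continuous_on {0..T} (d 2)"
    unfolding continuous_on_eq_continuous_within
    using v2 has_vector_derivative_continuous by blast
  obtain K2 where K2: "0 < K2" "\<And>t. t \<in> {0..T} \<Longrightarrow> norm (d 2 t) \<le> K2"
    using compact_imp_bounded[OF compact_continuous_image[OF d2 compact_Icc]]
    by (auto simp: bounded_pos)
  obtain K3 where K3: "0 < K3" "\<And>t. t \<in> {0..T} \<Longrightarrow> norm (d 3 t) \<le> K3"
    using compact_imp_bounded[OF compact_continuous_image[OF d3 compact_Icc]]
    by (auto simp: bounded_pos)
  have "norm (scheme_lhs \<sigma> B B0 \<tau> (\<lambda>k. v (real k * \<tau>)) n - g (real n * \<tau>))
      \<le> (K3 + \<sigma> * (C * (2 * K2))) * \<tau>\<^sup>2"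
    if tau: "0 < \<tau>" and N: "real N * \<tau> = T" and n: "1 \<le> n" "n \<le> N - 1" for N n \<tau>
  proof -
    define t where "t = real n * \<tau>"
    define p where "p = t + \<tau>"
    define m where "m = t - \<tau>"
    have "real (n + 1) * \<tau> \<le> T"
      unfolding N[symmetric] using n tau by (intro mult_right_mono) auto
    then have p_le: "p \<le> T"
      by (simp add: p_def t_def algebra_simps)
    have "1 * \<tau> \<le> real n * \<tau>"
      using n tau by (intro mult_right_mono) auto
    then have m_ge: "0 \<le> m"
      by (simp add: m_def t_def)
    have in_T: "p \<in> {0..T}" "t \<in> {0..T}" "m \<in> {0..T}" and t_open: "0 < t" "t < T"
      using p_le m_ge tau by (auto simp: p_def m_def)
    have vX: "v p \<in> X" "v t \<in> X" "v m \<in> X"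
      using sol in_T by (auto simp: ode_solution_def)
    \<comment> \<open>\<open>ode_solution\<close> provides some derivative \<open>v'\<close>;
      uniqueness of the derivative within a nondegenerate interval identifies it with
      \<open>d 1 t\<close>.\<close>
    have ode: "g t = d 1 t + B (v t)"
    proof -
      obtain v' where v': "(v has_vector_derivative v') (at t within {0..T})" "v' + B (v t) = g t"
        using bspec[OF sol[unfolded ode_solution_def] in_T(2)] by blast
      have "v' = d 1 t"
        using vector_derivative_unique_within_closed_interval[of 0 T t v v' "d 1 t"]
          v'(1) v[OF in_T(2)] t_open in_T(2) by simp
      then show ?thesis
        using v'(2) by simp
    qed
    \<comment> \<open>The weighted average is the middle value plus \<open>\<sigma>\<close> times
      the second difference; the term \<open>B0 (v t)\<close> then cancels against the explicit part
      of the scheme.\<close>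
    have B0_comb: "B0 (\<sigma> *\<^sub>R v p + (1 - 2 * \<sigma>) *\<^sub>R v t + \<sigma> *\<^sub>R v m)
        = \<sigma> *\<^sub>R B0 (v p - 2 *\<^sub>R v t + v m) + B0 (v t)"
    proof -
      have eq: "\<sigma> *\<^sub>R v p + (1 - 2 * \<sigma>) *\<^sub>R v t + \<sigma> *\<^sub>R v m
          = \<sigma> *\<^sub>R (v p - 2 *\<^sub>R v t + v m) + 1 *\<^sub>R v t"
        by (simp add: algebra_simps)
      show ?thesis
        unfolding eq using X vX
        by (subst is_adjoint_on_linear[OF B0 X X])
          (auto intro: subspace_add subspace_diff subspace_scale)
    qed
    have res: "scheme_lhs \<sigma> B B0 \<tau> (\<lambda>k. v (real k * \<tau>)) n - g (real n * \<tau>)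
        = ((1 / (2 * \<tau>)) *\<^sub>R (v p - v m) - d 1 t) + \<sigma> *\<^sub>R B0 (v p - 2 *\<^sub>R v t + v m)"
    proof -
      have "real (n + 1) * \<tau> = p" "real (n - 1) * \<tau> = m"
        using n by (auto simp: p_def m_def t_def algebra_simps of_nat_diff)
      then show ?thesis
        by (simp only: scheme_lhs_def t_def[symmetric] ode B0_comb) simp
    qed
    \<comment> \<open>In \<open>rp - rm\<close> the constant and quadratic Taylor terms cancel by
      symmetry, so two remainders of order \<open>\<tau> ^ 3\<close> are divided by
      \<open>2 * \<tau>\<close>.\<close>
    define rp where "rp = v p - v t - (p - t) *\<^sub>R d 1 t - ((p - t)\<^sup>2 / 2) *\<^sub>R d 2 t"
    define rm where "rm = v m - v t - (m - t) *\<^sub>R d 1 t - ((m - t)\<^sup>2 / 2) *\<^sub>R d 2 t"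
    have rp: "norm rp \<le> K3 * \<tau> ^ 3" and rm: "norm rm \<le> K3 * \<tau> ^ 3"
      using taylor_bound_2[OF _ in_T(2) in_T(1) _ v v1 v2 K3(2)]
        taylor_bound_2[OF _ in_T(2) in_T(3) _ v v1 v2 K3(2)] K3(1) tau
      by (simp_all add: rp_def rm_def p_def m_def)
    have "(1 / (2 * \<tau>)) *\<^sub>R (v p - v m) - d 1 t = (1 / (2 * \<tau>)) *\<^sub>R (rp - rm)"
      using tau by (simp add: rp_def rm_def p_def m_def algebra_simps flip: scaleR_add_left)
    also have "norm \<dots> \<le> (1 / (2 * \<tau>)) * (K3 * \<tau> ^ 3 + K3 * \<tau> ^ 3)"
      using tau norm_triangle_ineq4[of rp rm] rp rm by (simp add: divide_simps)
    also have "\<dots> = K3 * \<tau>\<^sup>2"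
      using tau by (simp add: field_simps eval_nat_numeral)
    finally have first: "norm ((1 / (2 * \<tau>)) *\<^sub>R (v p - v m) - d 1 t) \<le> K3 * \<tau>\<^sup>2" .
    \<comment> \<open>In \<open>qp + qm\<close> the linear terms cancel, so first-order Taylor
      expansion is enough for the second difference.\<close>
    define qp where "qp = v p - v t - (p - t) *\<^sub>R d 1 t"
    define qm where "qm = v m - v t - (m - t) *\<^sub>R d 1 t"
    have qp: "norm qp \<le> K2 * \<tau>\<^sup>2" and qm: "norm qm \<le> K2 * \<tau>\<^sup>2"
      using taylor_bound_1[OF _ in_T(2) in_T(1) _ v v1 K2(2)]
        taylor_bound_1[OF _ in_T(2) in_T(3) _ v v1 K2(2)] K2(1) tau
      by (simp_all add: qp_def qm_def p_def m_def)
    have "v p - 2 *\<^sub>R v t + v m = qp + qm"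
      by (simp add: qp_def qm_def p_def m_def scaleR_2)
    then have "norm (v p - 2 *\<^sub>R v t + v m) \<le> 2 * K2 * \<tau>\<^sup>2"
      using norm_triangle_ineq[of qp qm] qp qm by simp
    then have "C * norm (v p - 2 *\<^sub>R v t + v m) \<le> C * (2 * K2 * \<tau>\<^sup>2)"
      using C by (rule mult_left_mono)
    moreover have "norm (B0 (v p - 2 *\<^sub>R v t + v m)) \<le> C * norm (v p - 2 *\<^sub>R v t + v m)"
      using X vX by (intro bound subspace_add subspace_diff subspace_scale)
    ultimately have "\<sigma> * norm (B0 (v p - 2 *\<^sub>R v t + v m)) \<le> \<sigma> * (C * (2 * K2 * \<tau>\<^sup>2))"
      using sigma by (intro mult_left_mono) auto
    then have second: "norm (\<sigma> *\<^sub>R B0 (v p - 2 *\<^sub>R v t + v m)) \<le> \<sigma> * (C * (2 * K2 * \<tau>\<^sup>2))"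
      using sigma by simp
    then show ?thesis
      unfolding res using norm_triangle_mono[OF first second] by (simp only: distrib_right mult.assoc)
  qed
  then show "\<exists>M. \<forall>N \<tau> n. 0 < \<tau> \<and> real N * \<tau> = T \<and> 1 \<le> n \<and> n \<le> N - 1 \<longrightarrow>
      norm (scheme_lhs \<sigma> B B0 \<tau> (\<lambda>k. v (real k * \<tau>)) n - g (real n * \<tau>)) \<le> M * \<tau> ^ 2"
    by blast
qed

section \<open>Stability\<close>

lemma selfadjoint_on_op_D:
  assumes X: "subspace X" and B: "selfadjoint_on X B" and B0: "selfadjoint_on X B0"
  shows "selfadjoint_on X (op_D \<sigma> \<tau> B B0)"
  using B B0 unfolding is_adjoint_on_def op_D_def
  by (auto simp: inner_diff_left inner_diff_right intro!: subspace_scale[OF X] subspace_diff[OF X])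

text \<open>The levels are \<open>n\<close>, \<open>n + 1\<close>, \<open>n + 2\<close>, so the
  index \<open>n - 1\<close> in \<open>scheme_lhs\<close> never truncates. The balance is verified
  by expanding everything in the three values \<open>a\<close>, \<open>b\<close>, \<open>c\<close>.
  No sign condition on \<open>D\<close> enters here.\<close>

lemma scheme_energy_step:
  fixes B B0 :: "'a::real_inner \<Rightarrow> 'a" and w :: "nat \<Rightarrow> 'a"
  assumes X: "subspace X" and B: "selfadjoint_on X B" and B0: "selfadjoint_on X B0"
    and tau: "0 < \<tau>" and wX: "w (n + 2) \<in> X" "w (n + 1) \<in> X" "w n \<in> X"
    and scheme: "scheme_lhs \<sigma> B B0 \<tau> w (n + 1) = g"
  defines "D \<equiv> op_D \<sigma> \<tau> B B0"
    and "s \<equiv> \<lambda>n. (1/2) *\<^sub>R (w (n + 1) + w n)"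
    and "d \<equiv> \<lambda>n. (1/\<tau>) *\<^sub>R (w (n + 1) - w n)"
  shows "B (s (n + 1)) \<bullet> s (n + 1) + D (d (n + 1)) \<bullet> d (n + 1)
    \<le> B (s n) \<bullet> s n + D (d n) \<bullet> d n + \<tau> / 2 * (norm g)\<^sup>2"
proof -
  define a where "a = w (Suc (Suc n))"
  define b where "b = w (Suc n)"
  define c where "c = w n"
  have abc: "a \<in> X" "b \<in> X" "c \<in> X"
    using wX by (auto simp: a_def b_def c_def)
  define z where "z = a - c"
  have lin: "F (x + y) = F x + F y" "F (x - y) = F x - F y"
    if "selfadjoint_on X F" "x \<in> X" "y \<in> X" for F :: "'a \<Rightarrow> 'a" and x y
    using is_adjoint_on_linear[OF that(1) X X that(2,3), of 1 1]
      is_adjoint_on_linear[OF that(1) X X that(2,3), of 1 "-1"] by auto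
  have scale: "F (r *\<^sub>R x) = r *\<^sub>R F x"
    if "selfadjoint_on X F" "x \<in> X" for F :: "'a \<Rightarrow> 'a" and x r
    using is_adjoint_on_linear[OF that(1) X X that(2,2), of r 0] by simp
  note clo = abc subspace_add[OF X] subspace_diff[OF X] subspace_scale[OF X]
  have sa: "s (n + 1) = (1/2) *\<^sub>R (a + b)" "s n = (1/2) *\<^sub>R (b + c)"
    "d (n + 1) = (1/\<tau>) *\<^sub>R (a - b)" "d n = (1/\<tau>) *\<^sub>R (b - c)"
    by (auto simp: s_def d_def a_def b_def c_def)
  have g_eq: "g = (1 / (2 * \<tau>)) *\<^sub>R z + (\<sigma> *\<^sub>R B0 a + (1 - 2 * \<sigma>) *\<^sub>R B0 b + \<sigma> *\<^sub>R B0 c) + (B b - B0 b)"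
    unfolding scheme[symmetric] scheme_lhs_def z_def
    by (simp add: a_def[symmetric] b_def[symmetric] c_def[symmetric] lin[OF B0] scale[OF B0] clo)
  have g_z: "g \<bullet> z = (1 / (2 * \<tau>)) * (norm z)\<^sup>2
      + (\<sigma> * (B0 a \<bullet> z - 2 * (B0 b \<bullet> z) + B0 c \<bullet> z) + B b \<bullet> z)"
    unfolding g_eq by (simp add: inner_add_left inner_diff_left power2_norm_eq_inner algebra_simps)
  have sym: "F x \<bullet> y = F y \<bullet> x" if "selfadjoint_on X F" "x \<in> X" "y \<in> X" for F :: "'a \<Rightarrow> 'a" and x y
    using that unfolding is_adjoint_on_def by (metis inner_commute)
  note syms = sym[OF B, of b a] sym[OF B, of c a] sym[OF B, of c b]
    sym[OF B0, of b a] sym[OF B0, of c a] sym[OF B0, of c b]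
  \<comment> \<open>The factor \<open>\<tau>\<^sup>2\<close> in \<open>D\<close> cancels the two
    factors \<open>1 / \<tau>\<close> of the difference quotients.\<close>
  have D_scale: "D ((1/\<tau>) *\<^sub>R x) \<bullet> ((1/\<tau>) *\<^sub>R x) = \<sigma> * (B0 x \<bullet> x) - 1/4 * (B x \<bullet> x)"
    if "x \<in> X" for x
    using tau that
    by (simp add: D_def op_D_def scale[OF B] scale[OF B0] inner_diff_left power2_eq_square field_simps)
  \<comment> \<open>By symmetry the \<open>B\<close> terms collapse to
    \<open>B b \<bullet> z\<close>, and the \<open>B0\<close> terms to \<open>\<sigma>\<close> times
    \<open>B0\<close> of the second difference paired with \<open>z\<close>. These are the terms of
    \<open>g_z\<close> other than the dissipative one.\<close>
  have energy: "B (s (n + 1)) \<bullet> s (n + 1) + D (d (n + 1)) \<bullet> d (n + 1)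
      - (B (s n) \<bullet> s n + D (d n) \<bullet> d n) = g \<bullet> z - (1 / (2 * \<tau>)) * (norm z)\<^sup>2"
    unfolding sa D_scale[OF subspace_diff[OF X abc(1,2)]] D_scale[OF subspace_diff[OF X abc(2,3)]]
    unfolding g_z unfolding z_def
    by (simp add: lin[OF B] lin[OF B0] scale[OF B] scale[OF B0] clo inner_add_left inner_add_right inner_diff_left
        inner_diff_right syms field_simps)
  \<comment> \<open>Completing the square: the dissipative term absorbs all of the \<open>z\<close>
    part of \<open>g \<bullet> z\<close>, and what remains yields the constant 1/2 of the
    estimate.\<close>
  have "0 \<le> (norm (z - \<tau> *\<^sub>R g))\<^sup>2 / (2 * \<tau>)"
    using tau by simp
  also have "\<dots> = (1 / (2 * \<tau>)) * (norm z)\<^sup>2 - g \<bullet> z + \<tau> / 2 * (norm g)\<^sup>2"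
    using tau unfolding power2_norm_eq_inner
    by (simp add: inner_diff_left inner_diff_right inner_commute field_simps)
  finally show ?thesis
    using energy by linarith
qed

text \<open>Telescoping of the energy step. Nonnegativity of \<open>D\<close> enters once, at the
  end, to drop \<open>D (d n) \<bullet> d n\<close> at the last level.\<close>

lemma scheme_stable:
  fixes B B0 :: "'a::real_inner \<Rightarrow> 'a" and w :: "nat \<Rightarrow> 'a"
  assumes X: "subspace X" and B: "selfadjoint_on X B" and B0: "selfadjoint_on X B0"
    and nonneg: "nonneg_on X (op_D \<sigma> \<tau> B B0)"
    and tau: "0 < \<tau>" and wX: "\<And>n. n \<le> N \<Longrightarrow> w n \<in> X"
    and scheme: "\<And>n. n \<in> {1..N - 1} \<Longrightarrow> scheme_lhs \<sigma> B B0 \<tau> w n = g n"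
    and n: "n < N"
  defines "D \<equiv> op_D \<sigma> \<tau> B B0"
    and "s \<equiv> \<lambda>n. (1/2) *\<^sub>R (w (n + 1) + w n)"
  shows "B (s n) \<bullet> s n \<le> B (s 0) \<bullet> s 0
    + D ((1/\<tau>) *\<^sub>R (w 1 - w 0)) \<bullet> ((1/\<tau>) *\<^sub>R (w 1 - w 0))
    + (1/2) * (\<Sum>k = 1..n. \<tau> * (norm (g k))\<^sup>2)"
proof -
  define d where "d = (\<lambda>n. (1/\<tau>) *\<^sub>R (w (n + 1) - w n))"
  have "B (s n) \<bullet> s n + D (d n) \<bullet> d n \<le> B (s 0) \<bullet> s 0 + D (d 0) \<bullet> d 0
      + (1/2) * (\<Sum>k = 1..n. \<tau> * (norm (g k))\<^sup>2)"
    using n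
  proof (induction n)
    case (Suc n)
    have "B (s (n + 1)) \<bullet> s (n + 1) + D (d (n + 1)) \<bullet> d (n + 1)
        \<le> B (s n) \<bullet> s n + D (d n) \<bullet> d n + \<tau> / 2 * (norm (g (n + 1)))\<^sup>2"
      unfolding s_def d_def D_def using Suc.prems
      by (intro scheme_energy_step[OF X B B0 tau] wX scheme) auto
    with Suc show ?case
      by (simp add: algebra_simps)
  qed simp
  moreover have "d n \<in> X"
    unfolding d_def using n by (intro subspace_scale subspace_diff X wX) auto
  ultimately show ?thesis
    using nonneg by (auto simp: D_def nonneg_on_def d_def)
qed

section \<open>The vector operators of the decomposition\<close>

lemma subspace_prod_space:
  "(\<And>i. subspace (V i)) \<Longrightarrow> subspace (prod_space V)"
  by (simp add: prod_space_def subspace_def)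

lemma restrictions_inner:
  assumes "\<And>i. is_adjoint_on UNIV (V i) (R i) (Rs i)" and "w \<in> prod_space V"
  shows "restrictions R u \<bullet> w = u \<bullet> assemble Rs w"
  using assms
  by (auto simp: restrictions_def assemble_def prod_space_def is_adjoint_on_def inner_vec_def
      inner_sum_right)

lemma restrictions_in_prod_space:
  "(\<And>i. is_adjoint_on UNIV (V i) (R i) (Rs i)) \<Longrightarrow> restrictions R u \<in> prod_space V"
  by (auto simp: restrictions_def prod_space_def is_adjoint_on_def)

text \<open>\<open>restrictions R\<close> is adjoint to \<open>assemble Rs\<close>, and by
  \<open>dec\<close> \<open>assemble Rs\<close> maps \<open>restrictions R u\<close> back to
  \<open>u\<close>; hence the norm is preserved.\<close>

lemma norm_restrictions:
  assumes adj: "\<And>i. is_adjoint_on UNIV (V i) (R i) (Rs i)"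
    and dec: "u = (\<Sum>i\<in>UNIV. Rs i (R i u))"
  shows "norm (restrictions R u) = norm u"
proof -
  have "assemble Rs (restrictions R u) = u"
    using dec by (simp add: assemble_def restrictions_def)
  then show ?thesis
    using restrictions_inner[where w = "restrictions R u", OF adj restrictions_in_prod_space[of V R Rs, OF adj]]
    by (simp add: norm_eq_sqrt_inner)
qed

lemma op_B_eq_restrictions:
  assumes "linear A" and "\<And>i. linear (R i)"
  shows "op_B R Rs A v = restrictions R (A (assemble Rs v))"
  using assms by (simp add: op_B_def restrictions_def assemble_def linear_sum)

text \<open>The form of \<open>B\<close> is the form of \<open>A\<close> pulled back along
  \<open>assemble Rs\<close>; this turns the energy of \<open>w\<close> into the
  \<open>A\<close>-norm of \<open>y\<close>.\<close>

lemma op_B_inner: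
  assumes "linear A" and "\<And>i. linear (R i)"
    and "\<And>i. is_adjoint_on UNIV (V i) (R i) (Rs i)" and "w \<in> prod_space V"
  shows "op_B R Rs A v \<bullet> w = A (assemble Rs v) \<bullet> assemble Rs w"
  unfolding op_B_eq_restrictions[OF assms(1,2)] by (rule restrictions_inner[OF assms(3,4)])

lemma op_B0_inner:
  assumes "\<And>i. is_adjoint_on UNIV (V i) (R i) (Rs i)" and "w \<in> prod_space V"
  shows "op_B0 R Rs A v \<bullet> w = (\<Sum>i\<in>UNIV. A (Rs i (v $ i)) \<bullet> Rs i (w $ i))"
  using assms by (auto simp: op_B0_def prod_space_def is_adjoint_on_def inner_vec_def)

lemma selfadjoint_op_B:
  assumes "linear A" and "\<And>i. linear (R i)" and A: "selfadjoint_on UNIV A"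
    and adj: "\<And>i. is_adjoint_on UNIV (V i) (R i) (Rs i)"
  shows "selfadjoint_on (prod_space V) (op_B R Rs A)"
proof -
  have "op_B R Rs A v \<bullet> w = v \<bullet> op_B R Rs A w" if "v \<in> prod_space V" "w \<in> prod_space V" for v w
    using A that unfolding inner_commute[of v] is_adjoint_on_def
      op_B_inner[OF assms(1,2) adj that(1)] op_B_inner[OF assms(1,2) adj that(2)]
    by (metis UNIV_I inner_commute)
  then show ?thesis
    using restrictions_in_prod_space[of V R Rs, OF adj]
    by (simp add: is_adjoint_on_def op_B_eq_restrictions[OF assms(1,2)])
qed

lemma selfadjoint_op_B0:
  assumes A: "selfadjoint_on UNIV A"
    and adj: "\<And>i. is_adjoint_on UNIV (V i) (R i) (Rs i)"
  shows "selfadjoint_on (prod_space V) (op_B0 R Rs A)"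
proof -
  have "op_B0 R Rs A v \<bullet> w = v \<bullet> op_B0 R Rs A w" if "v \<in> prod_space V" "w \<in> prod_space V" for v w
    using A that unfolding inner_commute[of v] is_adjoint_on_def
      op_B0_inner[OF adj that(1)] op_B0_inner[OF adj that(2)]
    by (intro sum.cong refl) (metis UNIV_I inner_commute)
  moreover have "op_B0 R Rs A v \<in> prod_space V" for v
    using adj by (auto simp: op_B0_def prod_space_def is_adjoint_on_def)
  ultimately show ?thesis
    by (simp add: is_adjoint_on_def)
qed

lemma nonneg_op_D:
  fixes R :: "'p::finite \<Rightarrow> 'u::real_inner \<Rightarrow> 'v::real_inner"
  assumes A: "linear A" "selfadjoint_on UNIV A" "nonneg_on UNIV A"
    and R: "\<And>i. linear (R i)"
    and adj: "\<And>i. is_adjoint_on UNIV (V i) (R i) (Rs i)"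
    and sigma: "real CARD('p) / 4 \<le> \<sigma>"
  shows "nonneg_on (prod_space V) (op_D \<sigma> \<tau> (op_B R Rs A) (op_B0 R Rs A))"
  unfolding nonneg_on_def
proof
  fix v assume v: "v \<in> prod_space V"
  let ?q = "\<Sum>i\<in>UNIV. A (Rs i (v $ i)) \<bullet> Rs i (v $ i)"
  have "op_B R Rs A v \<bullet> v \<le> real CARD('p) * ?q"
    unfolding op_B_inner[OF A(1) R adj v] assemble_def by (rule quadratic_form_sum_le[OF A])
  \<comment> \<open>\<open>?q\<close> is the form of \<open>B0\<close> at \<open>v\<close>; it is
    nonnegative, so \<open>p\<close> may be replaced by the larger
    \<open>4 * \<sigma>\<close>.\<close>
  also have "\<dots> \<le> 4 * \<sigma> * ?q"
    using sigma A(3) by (intro mult_right_mono sum_nonneg) (auto simp: nonneg_on_def)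
  finally have "0 \<le> \<sigma> * (op_B0 R Rs A v \<bullet> v) - 1/4 * (op_B R Rs A v \<bullet> v)"
    by (simp add: op_B0_inner[OF adj v])
  then show "0 \<le> op_D \<sigma> \<tau> (op_B R Rs A) (op_B0 R Rs A) v \<bullet> v"
    by (simp add: op_D_def inner_diff_left)
qed

text \<open>Each diagonal block inherits the bound of \<open>A\<close>, since \<open>R i\<close> is
  a contraction and \<open>Rs i\<close> is isometric on \<open>V i\<close>. Estimating the norm by
  the sum of the component norms costs a factor \<open>p\<close>.\<close>

lemma op_B0_bounded:
  fixes R :: "'p::finite \<Rightarrow> 'u::real_inner \<Rightarrow> 'v::real_inner"
  assumes fin: "fin_dim_subspace (UNIV :: 'u set)" and A: "linear A"
    and adj: "\<And>i. is_adjoint_on UNIV (V i) (R i) (Rs i)"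
    and dec: "\<And>u. u = (\<Sum>i\<in>UNIV. Rs i (R i u))"
    and same: "\<And>i v. v \<in> V i \<Longrightarrow> R i (Rs i v) = v"
  obtains C where "0 \<le> C" "\<And>v. v \<in> prod_space V \<Longrightarrow> norm (op_B0 R Rs A v) \<le> C * norm v"
proof -
  obtain K where K: "0 \<le> K" "\<And>u. norm (A u) \<le> K * norm u"
    using linear_bounded_fin_dim[OF fin A] by blast
  have R: "norm (R i u) \<le> norm u" for i u
    using Finite_Cartesian_Product.norm_nth_le[of "restrictions R u" i]
    by (simp add: norm_restrictions[OF adj dec]) (simp add: restrictions_def)
  have Rs: "norm (Rs i x) = norm x" if "x \<in> V i" for i x
    using adj[of i] same[OF that] that unfolding is_adjoint_on_def norm_eq_sqrt_inner
    by (metis UNIV_I)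
  have "norm (op_B0 R Rs A v) \<le> real CARD('p) * K * norm v" if v: "v \<in> prod_space V" for v
  proof -
    have "norm (op_B0 R Rs A v $ i) \<le> K * norm v" for i
    proof -
      have "norm (op_B0 R Rs A v $ i) \<le> norm (A (Rs i (v $ i)))"
        by (simp add: op_B0_def R)
      also have "\<dots> \<le> K * norm (v $ i)"
        using K(2)[of "Rs i (v $ i)"] v by (simp add: Rs prod_space_def)
      also have "\<dots> \<le> K * norm v"
        using K(1) by (intro mult_left_mono Finite_Cartesian_Product.norm_nth_le)
      finally show ?thesis .
    qed
    then have "(\<Sum>i\<in>UNIV. norm (op_B0 R Rs A v $ i)) \<le> (\<Sum>i\<in>(UNIV::'p set). K * norm v)"
      by (intro sum_mono)
    moreover have "norm (op_B0 R Rs A v) \<le> (\<Sum>i\<in>UNIV. norm (op_B0 R Rs A v $ i))"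
      unfolding norm_vec_def by (intro L2_set_le_sum) simp
    ultimately show ?thesis
      by simp
  qed
  then show thesis
    using that K(1) by (metis mult_nonneg_nonneg of_nat_0_le_iff)
qed

theorem theorem2:
  fixes A :: "'u::real_inner \<Rightarrow> 'u"
    and V :: "'p::finite \<Rightarrow> 'v::real_inner set"
    and R :: "'p \<Rightarrow> 'u \<Rightarrow> 'v"
    and Rs :: "'p \<Rightarrow> 'v \<Rightarrow> 'u"
    and f :: "real \<Rightarrow> 'u"
    and u0 :: 'u
    and T \<sigma> :: real
  assumes U_fin_dim: "fin_dim_subspace (UNIV :: 'u set)"
    and V_fin_dim: "\<And>i. fin_dim_subspace (V i)"
    and A_linear: "linear A"
    and A_selfadjoint: "selfadjoint_on UNIV A"
    and A_pos_def: "pos_def A"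
    and R_linear: "\<And>i. linear (R i)"
    and Rs_adjoint: "\<And>i. is_adjoint_on UNIV (V i) (R i) (Rs i)"
    and direct_sum: "is_direct_sum (\<lambda>i. Rs i ` V i)"
    and decomposition: "\<And>u. u = (\<Sum>i\<in>UNIV. Rs i (R i u))"
    and R_Rs_same: "\<And>i v. v \<in> V i \<Longrightarrow> R i (Rs i v) = v"
    and R_Rs_other: "\<And>i j v. i \<noteq> j \<Longrightarrow> v \<in> V j \<Longrightarrow> R i (Rs j v) = 0"
    and T_pos: "0 < T"
    and sigma_pos: "0 < \<sigma>"
  defines "B \<equiv> op_B R Rs A"
    and "B0 \<equiv> op_B0 R Rs A"
    and "bV \<equiv> prod_space V"
    and "bf \<equiv> \<lambda>t. restrictions R (f t)"
    and "v0 \<equiv> restrictions R u0"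
  shows "order_of_approximation 2 T bV B bf (scheme_lhs \<sigma> B B0)
    \<and> (real CARD('p) / 4 \<le> \<sigma> \<longrightarrow>
        (\<forall>(N::nat) (\<tau>::real). 0 < \<tau> \<and> real N * \<tau> = T \<longrightarrow>
          (let D = op_D \<sigma> \<tau> B B0 in
            selfadjoint_on bV D \<and> nonneg_on bV D \<and>
            (\<forall>v1\<in>bV. \<forall>w :: nat \<Rightarrow> 'v ^ 'p.
               (\<forall>n\<le>N. w n \<in> bV) \<and> w 0 = v0 \<and> w 1 = v1 \<and>
               (\<forall>n\<in>{1..N - 1}. scheme_lhs \<sigma> B B0 \<tau> w n = bf (real n * \<tau>)) \<longrightarrow>
               (let y = (\<lambda>n. assemble Rs (w n));
                    yh = (\<lambda>n. (1/2) *\<^sub>R (y (n + 1) + y n))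
                in \<forall>n\<in>{1..N - 1}.
                  (energy_norm A (yh n))\<^sup>2
                  \<le> (energy_norm A (yh 0))\<^sup>2
                    + D ((1 / \<tau>) *\<^sub>R (v1 - v0)) \<bullet> ((1 / \<tau>) *\<^sub>R (v1 - v0))
                    + (1/2) * (\<Sum>k = 1..n. \<tau> * (norm (f (real k * \<tau>)))\<^sup>2))))))"
proof (intro conjI impI allI)
  have subV: "subspace (V i)" for i
    using V_fin_dim[of i] unfolding fin_dim_subspace_def by (metis subspace_span)
  have X: "subspace bV"
    unfolding bV_def by (rule subspace_prod_space[OF subV])
  have B: "selfadjoint_on bV B"
    unfolding bV_def B_def by (rule selfadjoint_op_B[OF A_linear R_linear A_selfadjoint Rs_adjoint])
  have B0: "selfadjoint_on bV B0"
    unfolding bV_def B0_def by (rule selfadjoint_op_B0[OF A_selfadjoint Rs_adjoint])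
  have A_nonneg: "nonneg_on UNIV A"
    using A_pos_def unfolding nonneg_on_def pos_def_def by (metis inner_zero_right order.refl order_less_imp_le)
  obtain C where "0 \<le> C" "\<And>v. v \<in> bV \<Longrightarrow> norm (B0 v) \<le> C * norm v"
    unfolding bV_def B0_def
    using op_B0_bounded[OF U_fin_dim A_linear Rs_adjoint decomposition R_Rs_same] by blast
  then show "order_of_approximation 2 T bV B bf (scheme_lhs \<sigma> B B0)"
    using sigma_pos by (intro scheme_order_two[OF X B0]) auto

  fix N :: nat and \<tau> :: real
  assume sigma: "real CARD('p) / 4 \<le> \<sigma>" and "0 < \<tau> \<and> real N * \<tau> = T"
  then have tau: "0 < \<tau>"
    by simp
  have D_nonneg: "nonneg_on bV (op_D \<sigma> \<tau> B B0)"
    unfolding bV_def B_def B0_def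
    by (rule nonneg_op_D[OF A_linear A_selfadjoint A_nonneg R_linear Rs_adjoint sigma])
  \<comment> \<open>Membership in \<open>bV\<close> is required because \<open>Rs i\<close> is
    constrained only on \<open>V i\<close>, so \<open>assemble Rs\<close> is known to be linear only
    there. Nonnegativity of \<open>A\<close> lets the square undo the root in
    \<open>energy_norm\<close>.\<close>
  have energy: "(energy_norm A ((1/2) *\<^sub>R (assemble Rs x + assemble Rs z)))\<^sup>2
      = B ((1/2) *\<^sub>R (x + z)) \<bullet> ((1/2) *\<^sub>R (x + z))" if xz: "x \<in> bV" "z \<in> bV" for x z
  proof -
    have "Rs i ((1/2) *\<^sub>R (x $ i) + (1/2) *\<^sub>R (z $ i)) = (1/2) *\<^sub>R Rs i (x $ i) + (1/2) *\<^sub>R Rs i (z $ i)" for i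
      using xz by (intro is_adjoint_on_linear[OF is_adjoint_on_sym[OF Rs_adjoint] subV subspace_UNIV])
        (auto simp: bV_def prod_space_def)
    then have as: "assemble Rs ((1/2) *\<^sub>R (x + z)) = (1/2) *\<^sub>R (assemble Rs x + assemble Rs z)"
      by (simp add: assemble_def scaleR_add_right sum.distrib scaleR_sum_right)
    have "(1/2) *\<^sub>R (x + z) \<in> prod_space V"
      using X xz unfolding bV_def by (intro subspace_scale subspace_add)
    then have "B ((1/2) *\<^sub>R (x + z)) \<bullet> ((1/2) *\<^sub>R (x + z))
        = A ((1/2) *\<^sub>R (assemble Rs x + assemble Rs z)) \<bullet> ((1/2) *\<^sub>R (assemble Rs x + assemble Rs z))"
      unfolding B_def by (simp only: op_B_inner[OF A_linear R_linear Rs_adjoint] as)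
    then show ?thesis
      using A_nonneg by (simp only: energy_norm_def nonneg_on_def) (simp only: real_sqrt_pow2 UNIV_I)
  qed
  \<comment> \<open>The indices \<open>0 + 1\<close> match what unfolding \<open>yh 0\<close>
    produces in the goal.\<close>
  have estimate: "(energy_norm A ((1/2) *\<^sub>R (assemble Rs (w (n + 1)) + assemble Rs (w n))))\<^sup>2
      \<le> (energy_norm A ((1/2) *\<^sub>R (assemble Rs (w (0 + 1)) + assemble Rs (w 0))))\<^sup>2
        + op_D \<sigma> \<tau> B B0 ((1 / \<tau>) *\<^sub>R (v1 - v0)) \<bullet> ((1 / \<tau>) *\<^sub>R (v1 - v0))
        + (1/2) * (\<Sum>k = 1..n. \<tau> * (norm (f (real k * \<tau>)))\<^sup>2)"
    if w: "\<forall>n\<le>N. w n \<in> bV" "w 0 = v0" "w 1 = v1"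
      "\<forall>n\<in>{1..N - 1}. scheme_lhs \<sigma> B B0 \<tau> w n = bf (real n * \<tau>)" and n: "n \<in> {1..N - 1}"
    for v1 w n
  proof -
    have norm_bf: "norm (bf t) = norm (f t)" for t
      unfolding bf_def by (rule norm_restrictions[OF Rs_adjoint decomposition])
    have "n < N"
      using n by auto
    then have wX: "w (n + 1) \<in> bV" "w n \<in> bV" "w (0 + 1) \<in> bV" "w 0 \<in> bV"
      using w(1) by auto
    show ?thesis
      unfolding energy[OF wX(1,2)] energy[OF wX(3,4)] w(2,3)[symmetric] norm_bf[symmetric]
      using w \<open>n < N\<close> by (intro scheme_stable[OF X B B0 D_nonneg tau]) auto
  qed
  show "let D = op_D \<sigma> \<tau> B B0 in
            selfadjoint_on bV D \<and> nonneg_on bV D \<and>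
            (\<forall>v1\<in>bV. \<forall>w :: nat \<Rightarrow> 'v ^ 'p.
               (\<forall>n\<le>N. w n \<in> bV) \<and> w 0 = v0 \<and> w 1 = v1 \<and>
               (\<forall>n\<in>{1..N - 1}. scheme_lhs \<sigma> B B0 \<tau> w n = bf (real n * \<tau>)) \<longrightarrow>
               (let y = (\<lambda>n. assemble Rs (w n));
                    yh = (\<lambda>n. (1/2) *\<^sub>R (y (n + 1) + y n))
                in \<forall>n\<in>{1..N - 1}.
                  (energy_norm A (yh n))\<^sup>2
                  \<le> (energy_norm A (yh 0))\<^sup>2
                    + D ((1 / \<tau>) *\<^sub>R (v1 - v0)) \<bullet> ((1 / \<tau>) *\<^sub>R (v1 - v0))
                    + (1/2) * (\<Sum>k = 1..n. \<tau> * (norm (f (real k * \<tau>)))\<^sup>2)))"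
    unfolding Let_def
    by (intro conjI ballI allI impI D_nonneg selfadjoint_on_op_D[OF X B B0] estimate) auto
qed

end
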